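(* Run the Unbiased Space Saving sketch with $m$ bins on an i.i.d. stream of items drawn from a discrete distribution with probabilities $p_1 \ge p_2 \ge \cdots$ (item $j$ drawn with probability $p_j$). If $p_1 > 1/m$, then with probability $1$, $Z_1(t) = 1$ for all sufficiently large $t$.
   Context: Unbiased Space Saving sketch with $m$ bins: maintain $m$ (item, count) pairs, counts initialized to $0$. For each new row with item $x_{new}$: if $x_{new}$ is a label, increment its count by $1$; otherwise choose a pair with the smallest count $\hat{N}_{min}$ (uniformly at random among all pairs sharing the smallest count), increment its count by $1$, and with probability $1/(\hat{N}_{min}+1)$ replace its label by $x_{new}$. $Z_i(t)$ is the indicator that item $i$ is the label of some pair after $t$ rows have been processed. *)

theory Defs
  imports "HOL-Probability.Probability"
begin

text \<open>Items are natural numbers; the paper's item j is item (j - 1) here,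
so the paper's item 1 is item 0.  A sketch state is a list of m
(label, count) pairs; a label is None before the pair has ever been labelled.\<close>

type_synonym uss_state = "(nat option \<times> nat) list"

definition uss_init :: "nat \<Rightarrow> uss_state" where
  "uss_init m = replicate m (None, 0)"

text \<open>One update step. The random input is (x, u, v): x the new item,
u uniform on [0,1) used to pick uniformly among the pairs of smallest count
(index floor(u*k) among the k tied pairs), v uniform on [0,1) used for the
replacement coin (replace iff v < 1/(Nmin+1)).\<close>

definition uss_step :: "uss_state \<Rightarrow> nat \<times> real \<times> real \<Rightarrow> uss_state" where
  "uss_step S r = (case r of (x, u, v) \<Rightarrow>
     if \<exists>i<length S. fst (S ! i) = Some x then
       (let i = (LEAST i. i < length S \<and> fst (S ! i) = Some x)
        in S[i := (fst (S ! i), snd (S ! i) + 1)])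
     else
       (let N = Min (snd ` set S);
            ties = filter (\<lambda>i. snd (S ! i) = N) [0..<length S];
            j = ties ! nat \<lfloor>u * real (length ties)\<rfloor>
        in S[j := (if v < 1 / real (N + 1) then Some x else fst (S ! j), N + 1)]))"

definition uss_run :: "nat \<Rightarrow> (nat \<times> real \<times> real) stream \<Rightarrow> nat \<Rightarrow> uss_state" where
  "uss_run m \<omega> t = fold (\<lambda>r S. uss_step S r) (stake t \<omega>) (uss_init m)"

definition uss_Z :: "nat \<Rightarrow> uss_state \<Rightarrow> bool" where
  "uss_Z i S \<longleftrightarrow> (\<exists>b\<in>set S. fst b = Some i)"

definition uss_noise :: "nat pmf \<Rightarrow> (nat \<times> real \<times> real) measure" where
  "uss_noise P = measure_pmf P \<Otimes>\<^sub>M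
     (uniform_measure lborel {0..<1::real} \<Otimes>\<^sub>M uniform_measure lborel {0..<1::real})"

end

theory Submission
  imports Defs
begin

text \<open>While item 0 labels a pair, the count of that pair grows at least as fast as the number of
arrivals of item 0, that is at rate \<open>p > 1/m\<close>, whereas the smallest count at time \<open>t\<close> is at most
\<open>t/m\<close>. Hence item 0 is safe forever once it has survived from a time below \<open>2N\<close> up to time \<open>LN\<close>,
for a suitable constant \<open>L\<close>. The smallest count grows linearly if at least \<open>m + 1\<close> items have
positive probability, so an eviction in the time interval \<open>[N, LN)\<close> needs a replacement coin below
\<open>b/N\<close>. With probability bounded away from 0, item 0 arrives at some time in \<open>[N, 2N)\<close> with a coin
below \<open>1/(2N)\<close>, which forces its entry, and no other coin of the interval is below \<open>b/N\<close>. These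
events depend on the noise only, and they are independent for \<open>N = L^k\<close>, so infinitely many of
them occur. If at most \<open>m\<close> items have positive probability, then labels are never evicted.\<close>

section \<open>Single steps of the sketch\<close>

definition min_count :: "uss_state \<Rightarrow> nat" where
  "min_count S = Min (snd ` set S)"

text \<open>\<open>uniform_measure\<close> lives on the whole real line, so samples lie in [0,1)
  only almost surely. The bound on the second component keeps the tie index in range.\<close>

definition valid_noise :: "(nat \<times> real \<times> real) stream \<Rightarrow> bool" where
  "valid_noise \<omega> \<longleftrightarrow> (\<forall>n. fst (snd (\<omega> !! n)) \<in> {0..<1} \<and> snd (snd (\<omega> !! n)) \<in> {0..<1})"

text \<open>\<open>None\<close> is exempt because all pairs start with it. Distinctness ensures that
  the pair incremented at an arrival is the very pair to which \<open>tracks\<close> refers.\<close>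

definition distinct_labels :: "uss_state \<Rightarrow> bool" where
  "distinct_labels S \<longleftrightarrow> (\<forall>i<length S. \<forall>j<length S.
     fst (S ! i) = fst (S ! j) \<longrightarrow> fst (S ! i) \<noteq> None \<longrightarrow> i = j)"

definition tracks :: "nat \<Rightarrow> nat \<Rightarrow> uss_state \<Rightarrow> bool" where
  "tracks x c S \<longleftrightarrow> (\<exists>i<length S. fst (S ! i) = Some x \<and> c \<le> snd (S ! i))"

text \<open>Never decreases, increases whenever an unlabelled item arrives, and bounds the smallest count
from below (see \<open>level_le\<close>).\<close>

definition level :: "uss_state \<Rightarrow> nat" where
  "level S = (\<Sum>i<length S. min (snd (S ! i)) (min_count S + 1))"

text \<open>Apart from the length of the list, this is all that is used about a step: later
  arguments hold for any choice among tied pairs. Strictness of \<open>u < 1\<close> keeps the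
  rounded index below the number of ties.\<close>

lemma uss_step_cases:
  assumes "S \<noteq> []" "0 \<le> u" "u < 1"
  obtains (hit) i where "i < length S" "fst (S ! i) = Some x"
      "uss_step S (x, u, v) = S[i := (Some x, snd (S ! i) + 1)]"
    | (miss) j where "\<And>i. i < length S \<Longrightarrow> fst (S ! i) \<noteq> Some x" "j < length S"
      "snd (S ! j) = min_count S"
      "uss_step S (x, u, v) =
         S[j := (if v < 1 / real (min_count S + 1) then Some x else fst (S ! j), min_count S + 1)]"
proof (cases "\<exists>i<length S. fst (S ! i) = Some x")
  case True
  define i where "i = (LEAST i. i < length S \<and> fst (S ! i) = Some x)"
  have i: "i < length S \<and> fst (S ! i) = Some x"
    unfolding i_def using True by (metis (mono_tags, lifting) LeastI)
  have "uss_step S (x, u, v) = S[i := (Some x, snd (S ! i) + 1)]"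
    using True i by (simp add: uss_step_def i_def[symmetric] Let_def)
  with i show ?thesis by (intro hit) auto
next
  case False
  define ties where "ties = filter (\<lambda>i. snd (S ! i) = min_count S) [0..<length S]"
  define n where "n = nat \<lfloor>u * real (length ties)\<rfloor>"
  have "min_count S \<in> snd ` set S"
    unfolding min_count_def using assms by (intro Min_in) auto
  then obtain k where "k < length S" "snd (S ! k) = min_count S"
    by (metis image_iff in_set_conv_nth)
  hence "k \<in> set ties" by (simp add: ties_def)
  hence pos: "length ties > 0" by (cases ties) auto
  have "u * real (length ties) < real (length ties)" using pos assms by simp
  hence "n < length ties"
    unfolding n_def using assms pos by (simp add: nat_less_iff floor_less_iff)
  hence "ties ! n \<in> set ties" by simp
  hence j: "ties ! n < length S" "snd (S ! (ties ! n)) = min_count S"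
    by (auto simp: ties_def)
  have "uss_step S (x, u, v) = S[ties ! n :=
      (if v < 1 / real (min_count S + 1) then Some x else fst (S ! (ties ! n)), min_count S + 1)]"
    unfolding uss_step_def by (simp only: prod.case if_not_P[OF False] Let_def ties_def n_def min_count_def)
  with j False show ?thesis by (intro miss) auto
qed

lemma length_uss_step [simp]: "length (uss_step S r) = length S"
  by (auto simp: uss_step_def Let_def split: prod.split)

lemma min_count_le: "i < length S \<Longrightarrow> min_count S \<le> snd (S ! i)"
  unfolding min_count_def by (intro Min_le) auto

lemma min_count_geI:
  assumes "S \<noteq> []" "\<And>i. i < length S \<Longrightarrow> c \<le> snd (S ! i)"
  shows "c \<le> min_count S"
  unfolding min_count_def using assms by (subst Min_ge_iff) (fastforce simp: in_set_conv_nth)+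

lemma min_count_update_ge:
  assumes "j < length S" "snd (S ! j) \<le> c"
  shows "min_count S \<le> min_count (S[j := (l, c)])"
proof (rule min_count_geI)
  fix i assume "i < length (S[j := (l, c)])"
  thus "min_count S \<le> snd (S[j := (l, c)] ! i)"
    using min_count_le[of i S] assms by (auto simp: nth_list_update)
qed (use assms in auto)

text \<open>The cap \<open>min_count S + 1\<close> can only rise, so every summand is monotone. A
  pair of smallest count lies strictly below the cap, hence raising its count raises its
  summand.\<close>

lemma level_update:
  assumes "j < length S" "snd (S ! j) < c"
  shows level_update_ge: "level S \<le> level (S[j := (l, c)])"
    and level_update_gt: "snd (S ! j) = min_count S \<Longrightarrow> level S < level (S[j := (l, c)])"
proof -
  let ?S = "S[j := (l, c)]"
  have mc: "min_count S \<le> min_count ?S"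
    using assms by (intro min_count_update_ge) auto
  have le: "min (snd (S ! i)) (min_count S + 1) \<le> min (snd (?S ! i)) (min_count ?S + 1)"
    if "i < length S" for i
    using that mc assms by (auto simp: nth_list_update min_def)
  show "level S \<le> level ?S"
    unfolding level_def using le by (auto intro: sum_mono)
  assume "snd (S ! j) = min_count S"
  hence "min (snd (S ! j)) (min_count S + 1) < min (snd (?S ! j)) (min_count ?S + 1)"
    using mc assms by (auto simp: min_def)
  thus "level S < level ?S"
    unfolding level_def using le assms(1)
    by (simp only: length_list_update, intro sum_strict_mono_ex1) (auto intro!: bexI[of _ j])
qed

lemma level_le: "level S \<le> length S * (min_count S + 1)"
  unfolding level_def by (rule order_trans[OF sum_bounded_above[where K = "min_count S + 1"]]) auto

text \<open>A miss raises a pair of smallest count and so raises the level strictly. A stagnating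
  level therefore signals a hit, which leaves all labels in place.\<close>

lemma level_uss_step:
  assumes "S \<noteq> []" "fst (snd r) \<in> {0..<1}"
  shows level_uss_step_ge: "level S \<le> level (uss_step S r)"
    and level_uss_step_eq: "level (uss_step S r) = level S \<Longrightarrow>
      map fst (uss_step S r) = map fst S \<and> Some (fst r) \<in> fst ` set S"
proof -
  obtain x u v where r: "r = (x, u, v)" by (cases r) auto
  have u: "0 \<le> u" "u < 1" using assms r by auto
  have "level S \<le> level (uss_step S r) \<and> (level (uss_step S r) = level S \<longrightarrow>
      map fst (uss_step S r) = map fst S \<and> Some (fst r) \<in> fst ` set S)"
    using assms(1) u
  proof (cases rule: uss_step_cases[where x = x and v = v])
    case (hit i)
    have "Some x \<in> fst ` set S" using hit(1,2) by (metis image_eqI nth_mem)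
    moreover have "map fst (S[i := (Some x, snd (S ! i) + 1)]) = map fst S"
      using hit(1,2) by (simp add: map_update list_update_same_conv)
    ultimately show ?thesis
      using hit level_update_ge[of i S "snd (S ! i) + 1" "Some x"] by (simp add: r)
  next
    case (miss j)
    define l where "l = (if v < 1 / real (min_count S + 1) then Some x else fst (S ! j))"
    have "level S < level (S[j := (l, min_count S + 1)])"
      using miss by (intro level_update_gt) auto
    thus ?thesis using miss(4) by (simp add: r l_def)
  qed
  thus "level S \<le> level (uss_step S r)"
    "level (uss_step S r) = level S \<Longrightarrow>
      map fst (uss_step S r) = map fst S \<and> Some (fst r) \<in> fst ` set S"
    by blast+
qed

lemma sum_counts_uss_step:
  assumes "S \<noteq> []" "fst (snd r) \<in> {0..<1}"
  shows "sum_list (map snd (uss_step S r)) = sum_list (map snd S) + 1"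
proof -
  obtain x u v where r: "r = (x, u, v)" by (cases r) auto
  have u: "0 \<le> u" "u < 1" using assms r by auto
  have *: "sum_list (map snd (S[j := (l, snd (S ! j) + 1)])) = sum_list (map snd S) + 1"
    if "j < length S" for j l
  proof -
    have "snd (S ! j) \<le> sum_list (map snd S)" using that by (intro member_le_sum_list) auto
    thus ?thesis using that by (simp add: map_update sum_list_update)
  qed
  show ?thesis using assms(1) u
    by (cases rule: uss_step_cases[where x = x and v = v]) (use * in \<open>force simp: r\<close>)+
qed

lemma min_count_le_sum:
  "length S * min_count S \<le> sum_list (map snd S)"
proof -
  have "sum_list (map snd S) = (\<Sum>i<length S. snd (S ! i))"
    by (simp add: sum_list_sum_nth atLeast0LessThan)
  also have "\<dots> \<ge> (\<Sum>i<length S. min_count S)"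
    by (intro sum_mono min_count_le) auto
  finally show ?thesis by simp
qed

lemma distinct_labels_uss_step:
  assumes "S \<noteq> []" "fst (snd r) \<in> {0..<1}" "distinct_labels S"
  shows "distinct_labels (uss_step S r)"
proof -
  obtain x u v where r: "r = (x, u, v)" by (cases r) auto
  have u: "0 \<le> u" "u < 1" using assms r by auto
  show ?thesis using assms(1) u
  proof (cases rule: uss_step_cases[where x = x and v = v])
    case (hit i)
    show ?thesis using hit(1,2) assms(3) unfolding hit(3) r distinct_labels_def
      by (metis fst_conv length_list_update nth_list_update)
  next
    case (miss j)
    define l where "l = (if v < 1 / real (min_count S + 1) then Some x else fst (S ! j))"
    have "l = Some x \<or> l = fst (S ! j)" by (simp add: l_def)
    hence "i = k" if "i < length S" "k < length S"
      "fst (S[j := (l, c)] ! i) = fst (S[j := (l, c)] ! k)" "fst (S[j := (l, c)] ! i) \<noteq> None"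
      for i k c
      using that miss(1)[of i] miss(1)[of k] miss(2)
        assms(3)[unfolded distinct_labels_def, rule_format, of i k]
      by (cases "i = j"; cases "k = j") auto
    thus ?thesis unfolding miss(4) r distinct_labels_def length_list_update l_def[symmetric] by blast
  qed
qed

section \<open>Entry and survival of a tracked label in one step\<close>

lemma tracks_uss_step_same:
  assumes "S \<noteq> []" "0 \<le> u" "u < 1" "distinct_labels S" "tracks x c S"
  shows "tracks x (Suc c) (uss_step S (x, u, v))"
proof -
  obtain k where k: "k < length S" "fst (S ! k) = Some x" "c \<le> snd (S ! k)"
    using assms(5) by (auto simp: tracks_def)
  show ?thesis using assms(1-3)
  proof (cases rule: uss_step_cases[where x = x and v = v])
    case (hit i)
    have "i = k" using assms(4) hit(1,2) k unfolding distinct_labels_def by (metis option.distinct(1))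
    thus ?thesis using hit k unfolding tracks_def by (intro exI[of _ k]) simp
  next
    case (miss j)
    thus ?thesis using k by blast
  qed
qed

text \<open>Eviction needs both a successful coin and a tracked pair of smallest count. Each
  alternative of the last hypothesis excludes one of the two.\<close>

lemma tracks_uss_step_other:
  assumes "S \<noteq> []" "0 \<le> u" "u < 1" "tracks y c S" "x \<noteq> y"
    and "1 / real (min_count S + 1) \<le> v \<or> min_count S < c"
  shows "tracks y c (uss_step S (x, u, v))"
proof -
  obtain k where k: "k < length S" "fst (S ! k) = Some y" "c \<le> snd (S ! k)"
    using assms(4) by (auto simp: tracks_def)
  show ?thesis using assms(1-3)
  proof (cases rule: uss_step_cases[where x = x and v = v])
    case (hit i)
    have "i \<noteq> k" using hit(2) k(2) assms(5) by auto
    thus ?thesis using hit k unfolding tracks_def by (intro exI[of _ k]) simp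
  next
    case (miss j)
    show ?thesis
    proof (cases "j = k")
      case True
      hence "1 / real (min_count S + 1) \<le> v" using miss k assms(6) by auto
      thus ?thesis using miss k True unfolding tracks_def by (intro exI[of _ k]) simp
    next
      case False
      thus ?thesis using miss k unfolding tracks_def by (intro exI[of _ k]) simp
    qed
  qed
qed

text \<open>If \<open>x\<close> is a label already, the arrival is a hit; otherwise the coin makes
  the replacement happen. The bound 0 forgets any inherited count.\<close>

lemma tracks_uss_step_enter:
  assumes "S \<noteq> []" "0 \<le> u" "u < 1" "v < 1 / real (min_count S + 1)"
  shows "tracks x 0 (uss_step S (x, u, v))"
  using assms(1-3)
proof (cases rule: uss_step_cases[where x = x and v = v])
  case (hit i)
  thus ?thesis unfolding tracks_def by (intro exI[of _ i]) simp
next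
  case (miss j)
  thus ?thesis using assms(4) unfolding tracks_def by (intro exI[of _ j]) simp
qed

lemma tracks_imp_uss_Z: "tracks x c S \<Longrightarrow> uss_Z x S"
  unfolding tracks_def uss_Z_def using nth_mem by blast

section \<open>Deterministic properties of runs\<close>

lemma uss_run_0 [simp]: "uss_run m \<omega> 0 = replicate m (None, 0)"
  by (simp add: uss_run_def uss_init_def)

lemma uss_run_Suc: "uss_run m \<omega> (Suc t) = uss_step (uss_run m \<omega> t) (\<omega> !! t)"
  by (simp add: uss_run_def stake_Suc del: stake.simps)

lemma length_uss_run [simp]: "length (uss_run m \<omega> t) = m"
  by (induction t) (simp_all add: uss_run_Suc)

lemma uss_run_nonempty: "m > 0 \<Longrightarrow> uss_run m \<omega> t \<noteq> []"
  using length_uss_run[of m \<omega> t] by force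

lemma sum_counts_uss_run:
  assumes "m > 0" "valid_noise \<omega>"
  shows "sum_list (map snd (uss_run m \<omega> t)) = t"
proof (induction t)
  case (Suc t)
  thus ?case using assms uss_run_nonempty[OF assms(1)]
    by (simp add: uss_run_Suc sum_counts_uss_step valid_noise_def)
qed (simp add: map_replicate_const sum_list_replicate)

text \<open>The counts sum to the number of processed rows, and the smallest is at most their
  mean.\<close>

lemma min_count_uss_run:
  assumes "m > 0" "valid_noise \<omega>"
  shows "m * min_count (uss_run m \<omega> t) \<le> t"
  using min_count_le_sum[of "uss_run m \<omega> t"] sum_counts_uss_run[OF assms] by simp

lemma distinct_labels_uss_run:
  assumes "m > 0" "valid_noise \<omega>"
  shows "distinct_labels (uss_run m \<omega> t)"
proof (induction t)
  case (Suc t)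
  thus ?case using assms uss_run_nonempty[OF assms(1)]
    by (simp add: uss_run_Suc distinct_labels_uss_step valid_noise_def)
qed (simp add: distinct_labels_def)

section \<open>Linear growth of the smallest count\<close>

lemma level_uss_run_window:
  assumes "m > 0" "valid_noise \<omega>"
  shows level_uss_run_mono: "level (uss_run m \<omega> a) \<le> level (uss_run m \<omega> (a + n))"
    and "level (uss_run m \<omega> (a + n)) = level (uss_run m \<omega> a) \<Longrightarrow>
        map fst (uss_run m \<omega> (a + n)) = map fst (uss_run m \<omega> a) \<and>
        (\<forall>i<n. Some (fst (\<omega> !! (a + i))) \<in> fst ` set (uss_run m \<omega> a))"
proof (induction n)
  case (Suc n)
  define S where "S = uss_run m \<omega> (a + n)"
  note st = level_uss_step[of S "\<omega> !! (a + n)"]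
  have S: "S \<noteq> []" "fst (snd (\<omega> !! (a + n))) \<in> {0..<1}"
    using assms uss_run_nonempty by (auto simp: S_def valid_noise_def)
  have run: "uss_run m \<omega> (a + Suc n) = uss_step S (\<omega> !! (a + n))"
    by (simp add: uss_run_Suc S_def)
  have ge: "level (uss_run m \<omega> a) \<le> level S" "level S \<le> level (uss_run m \<omega> (a + Suc n))"
    using Suc(1) st(1)[OF S] unfolding run S_def by simp_all
  {
    case 1
    show ?case using ge by linarith
  next
    case 2
    \<comment> \<open>The level cannot fall, so equality at the ends forces equality in between: the
      induction hypothesis freezes the labels up to the last step, and that step is a hit on one of
      them.\<close>
    hence eq: "level S = level (uss_run m \<omega> a)" "level (uss_step S (\<omega> !! (a + n))) = level S"
      using ge run by simp_all
    have IH: "map fst S = map fst (uss_run m \<omega> a)"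
      "\<forall>i<n. Some (fst (\<omega> !! (a + i))) \<in> fst ` set (uss_run m \<omega> a)"
      using Suc(2) eq(1) by (auto simp: S_def)
    have "fst ` set S = fst ` set (uss_run m \<omega> a)"
      using IH(1) by (metis list.set_map)
    thus ?case using st(2)[OF S eq(2)] IH run by (auto simp: less_Suc_eq)
  }
qed auto

text \<open>A stretch of \<open>m + 1\<close> different items cannot consist of labels only.\<close>

lemma level_uss_run_gt:
  assumes "m > 0" "valid_noise \<omega>" "\<And>i. i \<le> m \<Longrightarrow> fst (\<omega> !! (a + i)) = i"
  shows "level (uss_run m \<omega> a) < level (uss_run m \<omega> (a + Suc m))"
proof (rule ccontr)
  assume "\<not> ?thesis"
  hence "level (uss_run m \<omega> (a + Suc m)) = level (uss_run m \<omega> a)"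
    using level_uss_run_mono[OF assms(1,2), of a "Suc m"] by linarith
  hence *: "\<forall>i<Suc m. Some (fst (\<omega> !! (a + i))) \<in> fst ` set (uss_run m \<omega> a)"
    using level_uss_run_window(2)[OF assms(1,2)] by blast
  have "Some ` {..m} \<subseteq> fst ` set (uss_run m \<omega> a)"
  proof safe
    fix i assume "i \<le> m"
    thus "Some i \<in> fst ` set (uss_run m \<omega> a)" using *[rule_format, of i] assms(3)[of i] by simp
  qed
  hence "card (Some ` {..m}) \<le> card (fst ` set (uss_run m \<omega> a))"
    by (intro card_mono) auto
  also have "\<dots> \<le> card (set (uss_run m \<omega> a))" by (intro card_image_le) auto
  also have "\<dots> \<le> m" using card_length[of "uss_run m \<omega> a"] by simp
  finally show False by (simp add: card_image)
qed

text \<open>Time is cut into disjoint windows of length \<open>Suc m\<close>, and each window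
  showing the items 0 to \<open>m\<close> in this order raises the level. Fixing the order makes the
  windows independent events of a simple product probability.\<close>

lemma card_windows_le_level:
  assumes "m > 0" "valid_noise \<omega>"
  shows "card {j. j < n \<and> (\<forall>i\<le>m. fst (\<omega> !! (j * Suc m + i)) = i)} \<le> level (uss_run m \<omega> (n * Suc m))"
proof (induction n)
  case (Suc n)
  let ?W = "\<lambda>j. \<forall>i\<le>m. fst (\<omega> !! (j * Suc m + i)) = i"
  have eq: "Suc n * Suc m = n * Suc m + Suc m" by simp
  show ?case
  proof (cases "?W n")
    case True
    hence "{j. j < Suc n \<and> ?W j} = insert n {j. j < n \<and> ?W j}" by (auto simp: less_Suc_eq)
    hence "card {j. j < Suc n \<and> ?W j} = Suc (card {j. j < n \<and> ?W j})" by simp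
    also have "\<dots> \<le> level (uss_run m \<omega> (Suc n * Suc m))"
      unfolding eq using Suc level_uss_run_gt[OF assms, of "n * Suc m"] True by fastforce
    finally show ?thesis .
  next
    case False
    hence "{j. j < Suc n \<and> ?W j} = {j. j < n \<and> ?W j}" by (auto simp: less_Suc_eq)
    hence "card {j. j < Suc n \<and> ?W j} = card {j. j < n \<and> ?W j}" by simp
    thus ?thesis
      unfolding eq using Suc level_uss_run_mono[OF assms, of "n * Suc m" "Suc m"] by linarith
  qed
qed simp

text \<open>The level lies between the number of successful windows, at least \<open>q * n\<close>,
  and \<open>m\<close> times the smallest count plus one.\<close>

lemma min_count_linear_growth:
  assumes "m > 0" "valid_noise \<omega>" "q > 0"
    and win: "\<And>n. n \<ge> T \<Longrightarrow>
      q * real n \<le> real (card {j. j < n \<and> (\<forall>i\<le>m. fst (\<omega> !! (j * Suc m + i)) = i)})"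
    and t: "t \<ge> Suc T * Suc m"
  shows "real t \<le> 2 * real m * real (Suc m) / q * (real (min_count (uss_run m \<omega> t)) + 1)"
proof -
  define n where "n = t div Suc m"
  have n: "n \<ge> Suc T" unfolding n_def using t by (metis div_le_mono nonzero_mult_div_cancel_right nat.distinct(1))
  have tn: "n * Suc m \<le> t" "t < Suc n * Suc m"
    unfolding n_def by (metis div_times_less_eq_dividend, metis dividend_less_div_times zero_less_Suc mult_Suc add.commute)
  have "q * real n \<le> real (level (uss_run m \<omega> (n * Suc m)))"
    using win[of n] card_windows_le_level[OF assms(1,2), of n] n by (simp del: mult_Suc_right)
  also have "\<dots> \<le> real (level (uss_run m \<omega> t))"
    using level_uss_run_mono[OF assms(1,2), of "n * Suc m" "t - n * Suc m"] tn by simp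
  also have "\<dots> \<le> real (m * (min_count (uss_run m \<omega> t) + 1))"
    using level_le[of "uss_run m \<omega> t"] by (simp only: length_uss_run of_nat_le_iff)
  finally have 1: "q * real n \<le> real m * (real (min_count (uss_run m \<omega> t)) + 1)"
    by (simp add: algebra_simps)
  \<comment> \<open>The incomplete last window is absorbed by \<open>Suc n\<close> being at most
    \<open>2 * n\<close>, which is the source of the factor 2 in the bound.\<close>
  have "Suc n * Suc m \<le> (2 * n) * Suc m" using n by (intro mult_right_mono) auto
  hence "t \<le> 2 * n * Suc m" using tn by linarith
  hence "real t \<le> real (2 * n * Suc m)"
    by (simp only: of_nat_le_iff)
  also have "\<dots> = 2 * real (Suc m) / q * (q * real n)"
    using assms(3) by (simp, simp add: algebra_simps)
  also have "\<dots> \<le> 2 * real (Suc m) / q * (real m * (real (min_count (uss_run m \<omega> t)) + 1))"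
    using 1 assms(3) by (intro mult_left_mono) auto
  finally show ?thesis by (simp add: mult_ac)
qed

section \<open>Deterministic criteria for item 0 to stay\<close>

definition arrivals :: "(nat \<times> real \<times> real) stream \<Rightarrow> nat \<Rightarrow> nat" where
  "arrivals \<omega> t = card {i. i < t \<and> fst (\<omega> !! i) = 0}"

lemma arrivals_Suc: "arrivals \<omega> (Suc t) = arrivals \<omega> t + of_bool (fst (\<omega> !! t) = 0)"
proof -
  have "{i. i < Suc t \<and> fst (\<omega> !! i) = 0} =
      (if fst (\<omega> !! t) = 0 then insert t else id) {i. i < t \<and> fst (\<omega> !! i) = 0}"
    by (auto simp: less_Suc_eq)
  thus ?thesis by (simp add: arrivals_def)
qed

lemma arrivals_mono: "s \<le> t \<Longrightarrow> arrivals \<omega> s \<le> arrivals \<omega> t"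
  unfolding arrivals_def by (intro card_mono) auto

text \<open>The randomness is confined to hypotheses on one noise sequence. A single good block
  beyond \<open>T1\<close> and \<open>T2\<close> suffices; infinitely many are assumed because these
  thresholds depend on the sequence.\<close>

lemma eventually_tracked_if_good_blocks:
  fixes L m :: nat and \<epsilon> p b :: real
  assumes m: "m > 0" and \<omega>: "valid_noise \<omega>"
    and \<epsilon>: "0 < \<epsilon>" "1 / real m + 4 * \<epsilon> = p" "p \<le> 1" and L: "L \<ge> 2" "4 \<le> \<epsilon> * real L"
    and arr: "\<And>n. n \<ge> T1 \<Longrightarrow> \<bar>real (arrivals \<omega> n) - p * real n\<bar> \<le> \<epsilon> * real n"
    and growth: "\<And>t. t \<ge> T2 \<Longrightarrow> real t \<le> b * (real (min_count (uss_run m \<omega> t)) + 1)"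
    and blocks: "\<exists>\<^sub>\<infinity>k. \<exists>s\<in>{L^k..<2*L^k}. fst (\<omega> !! s) = 0 \<and> snd (snd (\<omega> !! s)) < 1 / (2 * real (L^k)) \<and>
        (\<forall>i\<in>{L^k..<L*L^k} - {s}. b / real (L^k) \<le> snd (snd (\<omega> !! i)))"
  shows "\<exists>T. \<forall>t\<ge>T. uss_Z 0 (uss_run m \<omega> t)"
proof -
  obtain k s where k: "k \<ge> T1 + T2 + 1" and s: "s \<in> {L^k..<2*L^k}" "fst (\<omega> !! s) = 0"
    "snd (snd (\<omega> !! s)) < 1 / (2 * real (L^k))"
    and rest: "\<And>i. i \<in> {L^k..<L*L^k} - {s} \<Longrightarrow> b / real (L^k) \<le> snd (snd (\<omega> !! i))"
    using blocks unfolding INFM_nat_le by meson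
  define N where "N = L ^ k"
  have "k < N" unfolding N_def using L(1) by (intro power_gt_expt) auto
  hence N: "N \<ge> T1" "N \<ge> T2" "N > 0" using k by auto
  let ?S = "uss_run m \<omega>"
  have U: "?S t \<noteq> []" "0 \<le> fst (snd (\<omega> !! t))" "fst (snd (\<omega> !! t)) < 1" for t
    using uss_run_nonempty[OF m] \<omega> by (auto simp: valid_noise_def)
  have Ssuc: "?S (Suc t) = uss_step (?S t) (fst (\<omega> !! t), fst (snd (\<omega> !! t)), snd (snd (\<omega> !! t)))" for t
    by (simp add: uss_run_Suc)
  have min_le: "real m * real (min_count (?S t)) \<le> real t" for t
    using min_count_uss_run[OF m \<omega>, of t] by (metis of_nat_le_iff of_nat_mult)
  \<comment> \<open>The tracked bound counts the arrivals of item 0 strictly after time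
    \<open>s\<close>; the arrival at \<open>s\<close> itself only secures the entry.\<close>
  have "tracks 0 (arrivals \<omega> t - arrivals \<omega> (Suc s)) (?S t)" if "Suc s \<le> t" for t
    using that
  proof (induction t rule: dec_induct)
    case base
    have "min_count (?S s) \<le> s"
      using min_count_uss_run[OF m \<omega>, of s] m by (metis One_nat_def Suc_leI dual_order.trans mult_le_mono1 nat_mult_1)
    \<comment> \<open>This is where the entry threshold \<open>1 / (2 * N)\<close> comes from: it
      lies below the true threshold whatever the state at time \<open>s\<close>.\<close>
    hence "min_count (?S s) + 1 \<le> 2 * N" using s(1) by (simp add: N_def)
    hence "real (min_count (?S s) + 1) \<le> 2 * real N" by linarith
    hence "1 / (2 * real N) \<le> 1 / real (min_count (?S s) + 1)"
      using N by (intro divide_left_mono) auto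
    hence "snd (snd (\<omega> !! s)) < 1 / real (min_count (?S s) + 1)" using s(3) unfolding N_def by linarith
    thus ?case unfolding Ssuc s(2) diff_self_eq_0 by (rule tracks_uss_step_enter[OF U])
  next
    case (step t)
    have mono: "arrivals \<omega> (Suc s) \<le> arrivals \<omega> t" using step by (intro arrivals_mono) auto
    show ?case
    proof (cases "fst (\<omega> !! t) = 0")
      case True
      have "tracks 0 (Suc (arrivals \<omega> t - arrivals \<omega> (Suc s))) (?S (Suc t))"
        unfolding Ssuc True by (rule tracks_uss_step_same[OF U distinct_labels_uss_run[OF m \<omega>] step.IH])
      thus ?thesis using mono True by (simp add: arrivals_Suc[of \<omega> t] Suc_diff_le)
    next
      case False
      have "1 / real (min_count (?S t) + 1) \<le> snd (snd (\<omega> !! t)) \<or>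
            min_count (?S t) < arrivals \<omega> t - arrivals \<omega> (Suc s)"
      proof (cases "t < L * N")
        case True
        have tN: "N \<le> t" using s(1) step(1) by (simp add: N_def)
        \<comment> \<open>Growth of the smallest count replaces the state-dependent threshold by
          \<open>b / N\<close>, which depends on the block only.\<close>
        hence "real N \<le> b * (real (min_count (?S t)) + 1)" using growth[of t] N by simp
        hence "1 / real (min_count (?S t) + 1) \<le> b / real N" using N by (simp add: field_simps)
        also have "\<dots> \<le> snd (snd (\<omega> !! t))"
          using rest[of t] tN True step(1) by (auto simp: N_def)
        finally show ?thesis ..
      next
        case False
        hence tN: "L * N \<le> t" by simp
        have "2 * N \<le> L * N" using L by simp
        hence t2N: "2 * N \<le> t" using tN by linarith
        have "arrivals \<omega> (Suc s) \<le> arrivals \<omega> (2 * N)"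
          using s(1) by (intro arrivals_mono) (simp add: N_def)
        \<comment> \<open>Arrivals up to the entry number at most \<open>4 * N\<close>. The choice
          of \<open>L\<close> makes this at most \<open>\<epsilon> * t\<close> once \<open>t\<close>
          has reached \<open>L * N\<close>.\<close>
        hence "real (arrivals \<omega> (Suc s)) \<le> (p + \<epsilon>) * real (2 * N)"
          using arr[of "2 * N"] N by (simp add: algebra_simps)
        also have "\<dots> \<le> 2 * real (2 * N)"
        proof (rule mult_right_mono)
          have "1 / real m > 0" using m by simp
          thus "p + \<epsilon> \<le> 2" using \<epsilon> by linarith
        qed simp
        also have "\<dots> \<le> \<epsilon> * (real L * real N)"
          using mult_right_mono[OF L(2), of "real N"] by (simp add: mult_ac)
        also have "\<dots> \<le> \<epsilon> * real t" using tN \<epsilon>(1) by (simp flip: of_nat_mult)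
        finally have 1: "real (arrivals \<omega> (Suc s)) \<le> \<epsilon> * real t" .
        have 2: "real (arrivals \<omega> t) \<ge> (p - \<epsilon>) * real t"
          using arr[of t] t2N N by (simp add: algebra_simps)
        have "real (min_count (?S t)) \<le> 1 / real m * real t"
          using min_le[of t] m by (simp add: field_simps)
        moreover have "(p - \<epsilon>) * real t = 1 / real m * real t + 3 * (\<epsilon> * real t)"
          using \<epsilon>(2) by (simp add: algebra_simps flip: \<epsilon>(2))
        moreover have "\<epsilon> * real t > 0" using \<epsilon>(1) t2N N by simp
        \<comment> \<open>Of the surplus \<open>4 * \<epsilon>\<close> over \<open>1 / m\<close>,
          one part is lost to the fluctuation of the arrivals and one to those before the entry; two
          parts remain.\<close>
        ultimately have "real (min_count (?S t)) + real (arrivals \<omega> (Suc s)) < real (arrivals \<omega> t)"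
          using 1 2 by linarith
        thus ?thesis by linarith
      qed
      hence "tracks 0 (arrivals \<omega> t - arrivals \<omega> (Suc s)) (?S (Suc t))"
        unfolding Ssuc by (rule tracks_uss_step_other[OF U step.IH False])
      thus ?thesis using False by (simp add: arrivals_Suc[of \<omega> t])
    qed
  qed
  thus ?thesis using tracks_imp_uss_Z by blast
qed

text \<open>With only \<open>m\<close> possible items, a miss always finds a pair of count 0. Such a
  pair has no label and the replacement probability is 1, so nothing is ever evicted.\<close>

lemma eventually_tracked_if_few_items:
  assumes m: "m > 0" and \<omega>: "valid_noise \<omega>"
    and items: "\<And>n. fst (\<omega> !! n) < m" and s: "fst (\<omega> !! s) = 0"
  shows "\<exists>T. \<forall>t\<ge>T. uss_Z 0 (uss_run m \<omega> t)"
proof -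
  let ?S = "uss_run m \<omega>"
  \<comment> \<open>Count 0 goes with the absence of a label because the threshold at count 0 is 1
    and valid coins lie strictly below it.\<close>
  define I where "I = (\<lambda>S :: uss_state. \<forall>i<length S. (snd (S ! i) = 0 \<longleftrightarrow> fst (S ! i) = None) \<and>
      (\<forall>y. fst (S ! i) = Some y \<longrightarrow> y < m))"
  have U: "?S t \<noteq> []" "0 \<le> fst (snd (\<omega> !! t))" "fst (snd (\<omega> !! t)) < 1" "snd (snd (\<omega> !! t)) < 1" for t
    using uss_run_nonempty[OF m] \<omega> by (auto simp: valid_noise_def)
  have Ssuc: "?S (Suc t) = uss_step (?S t) (fst (\<omega> !! t), fst (snd (\<omega> !! t)), snd (snd (\<omega> !! t)))" for t
    by (simp add: uss_run_Suc)
  have free: "min_count (?S t) = 0"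
    if I: "I (?S t)" and new: "\<And>i. i < m \<Longrightarrow> fst (?S t ! i) \<noteq> Some (fst (\<omega> !! t))" for t
  \<comment> \<open>Pigeonhole: if all counts were positive, the \<open>m\<close> pairs would carry
    distinct labels among the \<open>m - 1\<close> items other than the arriving one.\<close>
  proof (rule ccontr)
    assume "min_count (?S t) \<noteq> 0"
    hence nz: "snd (?S t ! i) \<noteq> 0" if "i < m" for i
      using min_count_le[of i "?S t"] that by simp
    have "inj_on (\<lambda>i. fst (?S t ! i)) {..<m}"
      using distinct_labels_uss_run[OF m \<omega>, of t] I nz
      unfolding distinct_labels_def inj_on_def I_def by simp
    moreover have "(\<lambda>i. fst (?S t ! i)) ` {..<m} \<subseteq> Some ` ({..<m} - {fst (\<omega> !! t)})"
    proof (rule image_subsetI)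
      fix i assume "i \<in> {..<m}"
      thus "fst (?S t ! i) \<in> Some ` ({..<m} - {fst (\<omega> !! t)})"
        using I nz[of i] new[of i] unfolding I_def by (cases "fst (?S t ! i)") auto
    qed
    ultimately have "card {..<m} \<le> card (Some ` ({..<m} - {fst (\<omega> !! t)}))"
      by (intro card_inj_on_le) auto
    also have "\<dots> = m - 1" using items by (simp add: card_image card_Diff_singleton)
    finally show False using m by simp
  qed
  have I: "I (?S t)" for t
  proof (induction t)
    case 0
    thus ?case by (simp add: I_def)
  next
    case (Suc t)
    show ?case using U(1-3)[of t]
    proof (cases rule: uss_step_cases[where x = "fst (\<omega> !! t)" and v = "snd (snd (\<omega> !! t))"])
      case (hit i)
      thus ?thesis using Suc items[of t] unfolding Ssuc I_def by (auto simp: nth_list_update)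
    next
      case (miss j)
      thus ?thesis using Suc items[of t] free[OF Suc] U(4)[of t]
        unfolding Ssuc I_def by (auto simp: nth_list_update)
    qed
  qed
  have Z: "\<exists>i<m. fst (?S t ! i) = Some 0" if "Suc s \<le> t" for t
    using that
  proof (induction t rule: dec_induct)
    case base
    show ?case using U(1-3)[of s]
    proof (cases rule: uss_step_cases[where x = "fst (\<omega> !! s)" and v = "snd (snd (\<omega> !! s))"])
      case (hit i)
      thus ?thesis using s unfolding Ssuc by (intro exI[of _ i]) auto
    next
      case (miss j)
      thus ?thesis using free[OF I] U(4)[of s] s unfolding Ssuc by (intro exI[of _ j]) auto
    qed
  next
    case (step t)
    then obtain k where k: "k < m" "fst (?S t ! k) = Some 0" by blast
    show ?case using U(1-3)[of t]
    proof (cases rule: uss_step_cases[where x = "fst (\<omega> !! t)" and v = "snd (snd (\<omega> !! t))"])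
      case (hit i)
      thus ?thesis using k unfolding Ssuc by (intro exI[of _ k]) (auto simp: nth_list_update)
    next
      case (miss j)
      hence "snd (?S t ! j) = 0" using free[OF I, of t] by simp
      hence "j \<noteq> k" using I[of t] k unfolding I_def by auto
      thus ?thesis using k miss unfolding Ssuc by (intro exI[of _ k]) auto
    qed
  qed
  have "uss_Z 0 (?S t)" if t: "t \<ge> Suc s" for t
  proof -
    obtain i where "i < m" "fst (?S t ! i) = Some 0" using Z[OF t] by blast
    hence "tracks 0 0 (?S t)" unfolding tracks_def by auto
    thus ?thesis by (rule tracks_imp_uss_Z)
  qed
  thus ?thesis by blast
qed

section \<open>Limit theorems for independent events\<close>

text \<open>Bridge to Hoeffding's inequality, which speaks of random variables: every preimage under
  an indicator lies in the sigma algebra generated by its event.\<close>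

lemma (in prob_space) indep_vars_indicator:
  assumes "indep_events E I"
  shows "indep_vars (\<lambda>_. borel) (\<lambda>i. indicator (E i) :: 'a \<Rightarrow> real) I"
proof -
  have ev: "E i \<in> events" if "i \<in> I" for i
    using assms that by (auto simp: indep_events_def)
  have "indep_sets (\<lambda>i. sigma_sets (space M) {E i}) I"
    using assms unfolding indep_events_def_alt
    by (rule indep_sets_sigma) (simp add: Int_stable_def)
  moreover have "{indicator (E i) -` A \<inter> space M | A. A \<in> sets (borel :: real measure)} \<subseteq> sigma_sets (space M) {E i}"
    if "i \<in> I" for i
  proof safe
    fix A :: "real set"
    interpret S: sigma_algebra "space M" "sigma_sets (space M) {E i}"
      using ev[OF that] sets.sets_into_space by (intro sigma_algebra_sigma_sets) auto
    have "E i \<in> sigma_sets (space M) {E i}" by auto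
    moreover have "indicator (E i) -` A \<inter> space M =
        (if 1 \<in> A then E i else {}) \<union> (if 0 \<in> A then space M - E i else {})"
      using sets.sets_into_space[OF ev[OF that]]
      by (auto simp: indicator_def of_bool_def split: if_splits)
    ultimately show "indicator (E i) -` A \<inter> space M \<in> sigma_sets (space M) {E i}"
      by auto
  qed
  ultimately have "indep_sets (\<lambda>i. {indicator (E i) -` A \<inter> space M | A. A \<in> sets (borel :: real measure)}) I"
    by (rule indep_sets_mono_sets)
  thus ?thesis unfolding indep_vars_def2 using ev by auto
qed

text \<open>Hoeffding's inequality bounds the probability of a deviation at \<open>n\<close> by a
  geometric sequence, and the first Borel-Cantelli lemma applies.\<close>

lemma (in prob_space) strong_law_events:
  assumes ind: "indep_events E (UNIV :: nat set)" and q: "\<And>i. prob (E i) = q" and \<epsilon>: "0 < \<epsilon>"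
  shows "AE \<omega> in M. \<exists>T. \<forall>n\<ge>T. \<bar>real (card {i. i < n \<and> \<omega> \<in> E i}) - q * real n\<bar> \<le> \<epsilon> * real n"
proof -
  have ev[measurable]: "E i \<in> events" for i using ind by (auto simp: indep_events_def)
  let ?X = "\<lambda>i. indicator (E i) :: 'a \<Rightarrow> real"
  have card_eq: "(\<Sum>i<n. ?X i \<omega>) = real (card {i. i < n \<and> \<omega> \<in> E i})" for n \<omega>
  proof -
    have "{..<n} \<inter> {i. \<omega> \<in> E i} = {i. i < n \<and> \<omega> \<in> E i}" by auto
    thus ?thesis by (simp add: indicator_def sum.If_cases)
  qed
  define B where "B = (\<lambda>n. {\<omega>\<in>space M. \<bar>(\<Sum>i<n. ?X i \<omega>) - q * real n\<bar> \<ge> \<epsilon> * real n})"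
  have "AE \<omega> in M. eventually (\<lambda>n. \<omega> \<in> space M - B n) sequentially"
  proof (rule borel_cantelli_AE1)
    show "B n \<in> sets M" for n unfolding B_def by measurable
    show "emeasure M (B n) < \<infinity>" for n by (simp add: emeasure_eq_measure)
    have bound: "prob (B n) \<le> 2 * exp (-2 * \<epsilon>\<^sup>2) ^ n" for n
    \<comment> \<open>\<open>B 0\<close> is the whole space, where the bound 2 is trivial;
      Hoeffding's inequality is applied to positive \<open>n\<close>.\<close>
    proof (cases "n = 0")
      case True
      thus ?thesis by (intro order_trans[OF prob_le_1]) simp
    next
      case False
      interpret Hoeffding_ineq M "{..<n}" ?X "\<lambda>_. 0" "\<lambda>_. 1" "q * real n"
      proof unfold_locales
        show "indep_vars (\<lambda>_. borel) ?X {..<n}"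
          using indep_vars_indicator[OF ind] by (rule indep_vars_subset) simp
        show "q * real n \<equiv> \<Sum>i<n. expectation (?X i)"
          by (simp add: q mult.commute)
      qed (auto simp: indicator_def)
      have "prob (B n) \<le> 2 * exp (-2 * (\<epsilon> * real n)\<^sup>2 / real n)"
        using Hoeffding_ineq_abs_ge[of "\<epsilon> * real n"] \<epsilon> False by (simp add: B_def)
      also have "-2 * (\<epsilon> * real n)\<^sup>2 / real n = real n * (-2 * \<epsilon>\<^sup>2)"
        using False by (simp add: power2_eq_square)
      finally show ?thesis by (simp only: exp_of_nat_mult)
    qed
    have "summable (\<lambda>n. 2 * exp (-2 * \<epsilon>\<^sup>2) ^ n)"
      using \<epsilon> by (intro summable_mult summable_geometric) simp
    thus "summable (\<lambda>n. prob (B n))"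
    proof (rule summable_comparison_test')
      show "norm (prob (B n)) \<le> 2 * exp (-2 * \<epsilon>\<^sup>2) ^ n" for n
        unfolding real_norm_def abs_of_nonneg[OF measure_nonneg] by (rule bound)
    qed
  qed
  thus ?thesis
  proof eventually_elim
    case (elim \<omega>)
    then obtain T where "\<And>n. n \<ge> T \<Longrightarrow> \<omega> \<in> space M - B n"
      by (auto simp: eventually_sequentially)
    hence "\<bar>real (card {i. i < n \<and> \<omega> \<in> E i}) - q * real n\<bar> \<le> \<epsilon> * real n" if "n \<ge> T" for n
      using that unfolding B_def card_eq by force
    thus ?case by blast
  qed
qed

text \<open>Continuity from above gives the limit superior of the events probability at least
  \<open>c\<close>, and the 0-1 law lifts this to 1.\<close>

lemma (in prob_space) borel_cantelli_indep_AE: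
  assumes ind: "indep_events E (UNIV :: nat set)" and c: "0 < c" and E: "\<And>k. k \<ge> K \<Longrightarrow> c \<le> prob (E k)"
  shows "AE \<omega> in M. \<exists>\<^sub>\<infinity>k. \<omega> \<in> E k"
proof -
  have ev[measurable]: "E i \<in> events" for i using ind by (auto simp: indep_events_def)
  let ?U = "\<lambda>n. \<Union>k\<in>{n..}. E k"
  have "(\<lambda>n. prob (?U n)) \<longlonglongrightarrow> prob (\<Inter>n. ?U n)"
    by (intro finite_Lim_measure_decseq) (force simp: decseq_def)+
  moreover have "c \<le> prob (?U n)" for n
  proof -
    have "c \<le> prob (E (max n K))" by (rule E) simp
    also have "\<dots> \<le> prob (?U n)" by (intro finite_measure_mono subsetI UN_I[of "max n K"]) auto
    finally show ?thesis .
  qed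
  ultimately have "c \<le> prob (\<Inter>n. ?U n)" by (intro LIMSEQ_le_const) auto
  hence "prob (\<Inter>n. ?U n) = 1" using borel_0_1_law[OF ind] c by auto
  hence "AE \<omega> in M. \<omega> \<in> (\<Inter>n. ?U n)" by (subst (asm) prob_eq_1) auto
  thus ?thesis by eventually_elim (auto simp: INFM_nat_le)
qed

section \<open>Independence in the space of i.i.d. streams\<close>

lemma (in prob_space) distr_stream_space_snth: "distr (stream_space M) M (\<lambda>\<omega>. \<omega> !! n) = M"
proof -
  have "distr (stream_space M) M (\<lambda>\<omega>. \<omega> !! n) = distr (\<Pi>\<^sub>M i\<in>UNIV. M) M (\<lambda>X. to_stream X !! n)"
    by (subst stream_space_eq_distr) (simp add: distr_distr comp_def)
  also have "\<dots> = M"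
    unfolding to_stream_def by simp (intro distr_PiM_component prob_space_axioms UNIV_I)
  finally show ?thesis .
qed

lemma (in prob_space) indep_vars_stream_space:
  "prob_space.indep_vars (stream_space M) (\<lambda>_. M) (\<lambda>n \<omega>. \<omega> !! n) UNIV"
proof -
  interpret S: prob_space "stream_space M" by (rule prob_space_stream_space)
  have "distr (stream_space M) (\<Pi>\<^sub>M i\<in>UNIV. M) (\<lambda>\<omega>. \<lambda>n\<in>UNIV. \<omega> !! n) =
        distr (\<Pi>\<^sub>M i\<in>UNIV. M) (\<Pi>\<^sub>M i\<in>UNIV. M) (\<lambda>X n. to_stream X !! n)"
    by (subst stream_space_eq_distr) (simp add: distr_distr comp_def measurable_snth_PiM restrict_UNIV)
  also have "\<dots> = (\<Pi>\<^sub>M i\<in>UNIV. M)"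
    by (simp add: to_stream_def)
  finally show ?thesis
    by (subst S.indep_vars_iff_distr_eq_PiM') (simp_all add: distr_stream_space_snth)
qed

lemma (in prob_space) prob_stream_space_cylinder:
  assumes J: "finite J" "J \<noteq> {}" and A[measurable]: "\<And>j. j \<in> J \<Longrightarrow> A j \<in> sets M"
  shows "measure (stream_space M) {\<omega>\<in>space (stream_space M). \<forall>j\<in>J. \<omega> !! j \<in> A j} = (\<Prod>j\<in>J. prob (A j))"
proof -
  interpret S: prob_space "stream_space M" by (rule prob_space_stream_space)
  have "{\<omega>\<in>space (stream_space M). \<forall>j\<in>J. \<omega> !! j \<in> A j} =
      (\<Inter>j\<in>J. (\<lambda>\<omega>. \<omega> !! j) -` A j \<inter> space (stream_space M))"
    using J by auto
  also have "S.prob \<dots> = (\<Prod>j\<in>J. S.prob ((\<lambda>\<omega>. \<omega> !! j) -` A j \<inter> space (stream_space M)))"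
    using J A by (intro S.indep_varsD[OF indep_vars_stream_space]) auto
  also have "\<dots> = (\<Prod>j\<in>J. prob (A j))"
  proof (rule prod.cong)
    fix j assume "j \<in> J"
    thus "S.prob ((\<lambda>\<omega>. \<omega> !! j) -` A j \<inter> space (stream_space M)) = prob (A j)"
      using A by (subst (2) distr_stream_space_snth[symmetric, of j]) (simp add: measure_distr)
  qed simp
  finally show ?thesis .
qed

text \<open>Disjoint groups of independent coordinates are independent. Locality of \<open>Q\<close>
  is a hypothesis so that the events can be written on whole streams, without restriction to a
  block.\<close>

lemma (in prob_space) indep_events_stream_space_blocks:
  assumes K: "disjoint_family K"
    and meas: "\<And>k. {f\<in>space (\<Pi>\<^sub>M i\<in>K k. M). Q k f} \<in> sets (\<Pi>\<^sub>M i\<in>K k. M)"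
    and local: "\<And>k f. Q k (restrict f (K k)) = Q k f"
  shows "prob_space.indep_events (stream_space M) (\<lambda>k. {\<omega>\<in>space (stream_space M). Q k (\<lambda>i. \<omega> !! i)}) UNIV"
proof -
  interpret S: prob_space "stream_space M" by (rule prob_space_stream_space)
  have "S.indep_vars (\<lambda>k. \<Pi>\<^sub>M i\<in>K k. M) (\<lambda>k \<omega>. restrict (\<lambda>i. \<omega> !! i) (K k)) UNIV"
    using K by (intro S.indep_vars_restrict[OF indep_vars_stream_space]) auto
  from S.indep_eventsI_indep_vars[OF this, of Q] show ?thesis
    using meas by (simp add: local)
qed

section \<open>Almost sure properties of the noise\<close>

lemma uniform_measure_unit_interval:
  fixes c :: real
  assumes "0 \<le> c" "c \<le> 1"
  shows "measure (uniform_measure lborel {0..<1}) {v. v < c} = c"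
    and "measure (uniform_measure lborel {0..<1}) {v. c \<le> v} = 1 - c"
proof -
  have "{0..<1} \<inter> {v. v < c} = {0..<c}" "{0..<1} \<inter> {v. c \<le> v} = {c..<1}"
    using assms by auto
  thus "measure (uniform_measure lborel {0..<1}) {v. v < c} = c"
    "measure (uniform_measure lborel {0..<1}) {v. c \<le> v} = 1 - c"
    using assms by (simp_all add: measure_uniform_measure)
qed

lemma prob_space_unit_interval: "prob_space (uniform_measure lborel {0..<1::real})"
  by (rule prob_space_uniform_measure) auto

lemma prob_space_uss_noise: "prob_space (uss_noise P)"
  unfolding uss_noise_def
  by (intro prob_space_pair prob_space_unit_interval prob_space_measure_pmf)

lemma sets_uss_noise [measurable_cong]:
  "sets (uss_noise P) = sets (count_space UNIV \<Otimes>\<^sub>M borel \<Otimes>\<^sub>M borel)"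
  unfolding uss_noise_def by (intro sets_pair_measure_cong) auto

lemma sets_uss_noise_times [measurable]:
  assumes "W \<in> sets borel" "V \<in> sets borel"
  shows "X \<times> W \<times> V \<in> sets (uss_noise P)"
  unfolding sets_uss_noise using assms by (intro pair_measureI) auto

lemma sets_uss_noise_item [measurable]: "X \<times> UNIV \<in> sets (uss_noise P)"
  using sets_uss_noise_times[of UNIV UNIV X P] by simp

lemma space_uss_noise [simp]: "space (uss_noise P) = UNIV"
  by (simp add: uss_noise_def space_pair_measure)

lemma measure_uss_noise_times:
  assumes [measurable]: "W \<in> sets borel" "V \<in> sets borel"
  shows "measure (uss_noise P) (X \<times> W \<times> V) = measure_pmf.prob P X *
    (measure (uniform_measure lborel {0..<1}) W * measure (uniform_measure lborel {0..<1}) V)"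
proof -
  let ?U = "uniform_measure lborel {0..<1::real}"
  interpret U: prob_space ?U by (rule prob_space_unit_interval)
  interpret UU: prob_space "?U \<Otimes>\<^sub>M ?U" by (intro prob_space_pair prob_space_unit_interval)
  have "W \<in> sets ?U" "V \<in> sets ?U" by simp_all
  hence "UU.prob (W \<times> V) = U.prob W * U.prob V"
    by (simp add: measure_def U.emeasure_pair_measure_Times enn2real_mult del: emeasure_uniform_measure)
  moreover have "W \<times> V \<in> sets (?U \<Otimes>\<^sub>M ?U)" by (intro pair_measureI) auto
  hence "measure (uss_noise P) (X \<times> W \<times> V) = measure_pmf.prob P X * UU.prob (W \<times> V)"
    unfolding uss_noise_def
    by (simp add: measure_def UU.emeasure_pair_measure_Times enn2real_mult del: emeasure_uniform_measure)
  ultimately show ?thesis by simp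
qed

lemma measure_uss_noise_item: "measure (uss_noise P) (X \<times> UNIV) = measure_pmf.prob P X"
  using measure_uss_noise_times[of UNIV UNIV P X] prob_space.prob_space[OF prob_space_unit_interval]
  by simp

lemma AE_valid_noise: "AE \<omega> in stream_space (uss_noise P). valid_noise \<omega>"
proof -
  interpret prob_space "uss_noise P" by (rule prob_space_uss_noise)
  have "prob (UNIV \<times> {0..<1} \<times> {0..<1}) = 1"
    by (subst measure_uss_noise_times) (auto simp: measure_uniform_measure)
  moreover have "UNIV \<times> {0..<1} \<times> {0..<1::real} \<in> sets (uss_noise P)" by measurable
  ultimately have "AE r in uss_noise P. r \<in> UNIV \<times> {0..<1} \<times> {0..<1}"
    by (subst (asm) prob_eq_1) auto
  hence "AE r in uss_noise P. fst (snd r) \<in> {0..<1} \<and> snd (snd r) \<in> {0..<1}"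
    by eventually_elim auto
  from AE_stream_all[OF _ this] show ?thesis
    unfolding stream_all_def valid_noise_def by simp
qed

lemma AE_items_in_set_pmf: "AE \<omega> in stream_space (uss_noise P). \<forall>n. fst (\<omega> !! n) \<in> set_pmf P"
proof -
  interpret prob_space "uss_noise P" by (rule prob_space_uss_noise)
  have "prob (set_pmf P \<times> UNIV) = 1"
    by (simp add: measure_uss_noise_item measure_pmf.prob_eq_1 AE_measure_pmf_iff)
  moreover have "set_pmf P \<times> UNIV \<in> sets (uss_noise P)" by (rule sets_uss_noise_item)
  ultimately have "AE r in uss_noise P. r \<in> set_pmf P \<times> UNIV"
    by (subst (asm) prob_eq_1) auto
  hence "AE r in uss_noise P. fst r \<in> set_pmf P"
    by eventually_elim auto
  from AE_stream_all[OF _ this] show ?thesis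
    unfolding stream_all_def by simp
qed

section \<open>Frequencies of arrivals and of windows\<close>

lemma AE_arrival_frequency:
  assumes "0 < \<epsilon>"
  shows "AE \<omega> in stream_space (uss_noise P). \<exists>T. \<forall>n\<ge>T.
    \<bar>real (card {i. i < n \<and> fst (\<omega> !! i) = x}) - pmf P x * real n\<bar> \<le> \<epsilon> * real n"
proof -
  interpret prob_space "uss_noise P" by (rule prob_space_uss_noise)
  interpret S: prob_space "stream_space (uss_noise P)" by (rule prob_space_stream_space)
  define E where "E = (\<lambda>k. {\<omega>\<in>space (stream_space (uss_noise P)). fst (\<omega> !! k) = x})"
  have "S.indep_events E UNIV"
    unfolding E_def
    by (rule indep_events_stream_space_blocks[where K = "\<lambda>k. {k}" and Q = "\<lambda>k f. fst (f k) = x"])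
       (auto simp: disjoint_family_on_def)
  moreover have "S.prob (E k) = pmf P x" for k
    using prob_stream_space_cylinder[of "{k}" "\<lambda>_. {x} \<times> UNIV"] unfolding E_def
    by (simp add: measure_uss_noise_item measure_pmf_single mem_Times_iff sets_uss_noise_item)
  ultimately have "AE \<omega> in stream_space (uss_noise P). \<exists>T. \<forall>n\<ge>T.
      \<bar>real (card {i. i < n \<and> \<omega> \<in> E i}) - pmf P x * real n\<bar> \<le> \<epsilon> * real n"
    using assms by (rule S.strong_law_events)
  with AE_space show ?thesis by eventually_elim (auto simp: E_def)
qed

lemma AE_window_frequency:
  assumes "0 < \<epsilon>"
  shows "AE \<omega> in stream_space (uss_noise P). \<exists>T. \<forall>n\<ge>T.
    \<bar>real (card {j. j < n \<and> (\<forall>i\<le>m. fst (\<omega> !! (j * Suc m + i)) = i)}) - (\<Prod>i\<le>m. pmf P i) * real n\<bar>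
      \<le> \<epsilon> * real n"
proof -
  interpret prob_space "uss_noise P" by (rule prob_space_uss_noise)
  interpret S: prob_space "stream_space (uss_noise P)" by (rule prob_space_stream_space)
  define E where "E = (\<lambda>j. {\<omega>\<in>space (stream_space (uss_noise P)). \<forall>i\<le>m. fst (\<omega> !! (j * Suc m + i)) = i})"
  define K where "K = (\<lambda>j. (\<lambda>i. j * Suc m + i) ` {..m})"
  have in_K: "j * Suc m + i \<in> K j" if "i \<le> m" for i j
    using that by (auto simp: K_def)
  \<comment> \<open>Division by the window length recovers the index of the window, so distinct
    windows share no position.\<close>
  have "x div Suc m = j" if "x \<in> K j" for x j
    using that unfolding K_def
    by (auto simp del: mult_Suc_right simp add: div_mult_self3 less_Suc_eq_le)
  hence "disjoint_family K" unfolding disjoint_family_on_def by blast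
  moreover have "{f\<in>space (\<Pi>\<^sub>M i\<in>K j. uss_noise P). \<forall>i\<le>m. fst (f (j * Suc m + i)) = i}
      \<in> sets (\<Pi>\<^sub>M i\<in>K j. uss_noise P)" for j
  proof -
    have coord: "{f\<in>space (\<Pi>\<^sub>M i\<in>K j. uss_noise P). fst (f n) = i} \<in> sets (\<Pi>\<^sub>M i\<in>K j. uss_noise P)"
      if "n \<in> K j" for n i
    proof -
      have "(\<lambda>f. fst (f n)) \<in> measurable (\<Pi>\<^sub>M i\<in>K j. uss_noise P) (count_space UNIV)"
        by (rule measurable_compose[OF measurable_component_singleton[OF that]]) measurable
      from measurable_sets[OF this, of "{i}"] show ?thesis
        by (simp add: vimage_def Int_def conj_commute)
    qed
    have "{f\<in>space (\<Pi>\<^sub>M i\<in>K j. uss_noise P). \<forall>i\<in>{..m}. fst (f (j * Suc m + i)) = i}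
        \<in> sets (\<Pi>\<^sub>M i\<in>K j. uss_noise P)"
    proof (rule sets.sets_Collect_finite_All)
      fix i assume "i \<in> {..m}"
      hence "j * Suc m + i \<in> K j" by (intro in_K) (simp only: atMost_iff)
      thus "{f\<in>space (\<Pi>\<^sub>M i\<in>K j. uss_noise P). fst (f (j * Suc m + i)) = i} \<in> sets (\<Pi>\<^sub>M i\<in>K j. uss_noise P)"
        by (rule coord)
    qed (rule finite_atMost)
    thus ?thesis by (simp only: Ball_def atMost_iff)
  qed
  moreover have "(\<forall>i\<le>m. fst (restrict f (K j) (j * Suc m + i)) = i) = (\<forall>i\<le>m. fst (f (j * Suc m + i)) = i)"
    for j and f :: "nat \<Rightarrow> nat \<times> real \<times> real"
    by (intro all_cong) (simp only: in_K restrict_apply' simp_thms)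
  ultimately have "S.indep_events E UNIV"
    unfolding E_def
    by (rule indep_events_stream_space_blocks[where Q = "\<lambda>j f. \<forall>i\<le>m. fst (f (j * Suc m + i)) = i"])
  moreover have "S.prob (E j) = (\<Prod>i\<le>m. pmf P i)" for j
  proof -
    have ball_K: "(\<forall>n\<in>K j. Q n) = (\<forall>i\<le>m. Q (j * Suc m + i))" for Q
      unfolding K_def by blast
    have fin: "finite (K j)" by (simp add: K_def)
    have ne: "K j \<noteq> {}" using in_K[OF le0] by blast
    have inj: "inj_on (\<lambda>i. j * Suc m + i) {..m}" by (rule inj_onI) (simp only: add_left_cancel)
    \<comment> \<open>Subtracting the start of the window from an absolute position gives the item
      required there.\<close>
    have "E j = {\<omega>\<in>space (stream_space (uss_noise P)). \<forall>n\<in>K j. \<omega> !! n \<in> {n - j * Suc m} \<times> UNIV}"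
      unfolding E_def ball_K
      by (simp only: mem_Times_iff singleton_iff UNIV_I simp_thms diff_add_inverse)
    also have "S.prob \<dots> = (\<Prod>n\<in>K j. prob ({n - j * Suc m} \<times> UNIV))"
      by (rule prob_stream_space_cylinder[OF fin ne sets_uss_noise_item])
    also have "\<dots> = (\<Prod>i\<le>m. pmf P i)"
      unfolding K_def by (subst prod.reindex[OF inj])
        (simp only: comp_def diff_add_inverse measure_uss_noise_item measure_pmf_single)
    finally show ?thesis .
  qed
  ultimately have "AE \<omega> in stream_space (uss_noise P). \<exists>T. \<forall>n\<ge>T.
      \<bar>real (card {i. i < n \<and> \<omega> \<in> E i}) - (\<Prod>i\<le>m. pmf P i) * real n\<bar> \<le> \<epsilon> * real n"
    using assms by (rule S.strong_law_events)
  with AE_space show ?thesis by eventually_elim (simp add: E_def del: mult_Suc_right)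
qed

section \<open>Good blocks occur infinitely often\<close>

lemma exp_le_one_minus_power:
  fixes y :: real
  assumes "0 \<le> y" "y \<le> 1 / 2"
  shows "exp (- 2 * y * real n) \<le> (1 - y) ^ n"
proof -
  have "y * (2 * y) \<le> y * 1" using assms by (intro mult_left_mono) auto
  hence "- 2 * y \<le> - y - 2 * y\<^sup>2" by (simp add: power2_eq_square)
  also have "\<dots> \<le> ln (1 - y)" using assms by (rule ln_one_minus_pos_lower_bound)
  finally have "exp (- 2 * y) \<le> 1 - y" using assms by (subst (asm) ln_ge_iff) auto
  hence "exp (- 2 * y) ^ n \<le> (1 - y) ^ n" by (intro power_mono) auto
  thus ?thesis by (simp add: exp_of_nat_mult[symmetric] mult_ac)
qed

text \<open>Each of the \<open>N\<close> choices of \<open>s\<close> contributes at least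
  \<open>pmf P x / (2 * N)\<close> times an exponential factor. The events are disjoint, so
  summation cancels \<open>N\<close> and leaves a bound common to all blocks.\<close>

lemma prob_good_block_ge:
  fixes N L :: nat and b :: real
  assumes b: "1 \<le> b" "2 * b \<le> real N" and L: "2 \<le> L"
  shows "pmf P x / 2 * exp (- 2 * b * real L) \<le> measure (stream_space (uss_noise P))
    {\<omega>\<in>space (stream_space (uss_noise P)). \<exists>s\<in>{N..<2*N}. \<forall>i\<in>{N..<L*N}. \<omega> !! i \<in>
      (if i = s then {x} \<times> UNIV \<times> {v. v < 1 / (2 * real N)} else UNIV \<times> UNIV \<times> {v. b / real N \<le> v})}"
    (is "_ \<le> measure ?M {\<omega>\<in>_. \<exists>s\<in>_. \<forall>i\<in>?I. _ \<in> ?A s i}")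
proof -
  interpret prob_space "uss_noise P" by (rule prob_space_uss_noise)
  interpret S: prob_space ?M by (rule prob_space_stream_space)
  have N: "0 < N" using b by (cases N) auto
  have LN: "2 * N \<le> L * N" using L by simp
  define y where "y = b / real N"
  have y: "0 \<le> y" "y \<le> 1 / 2" using b N by (auto simp: y_def field_simps)
  define E where "E = (\<lambda>s. {\<omega>\<in>space ?M. \<forall>i\<in>?I. \<omega> !! i \<in> ?A s i})"
  have A[measurable]: "?A s i \<in> sets (uss_noise P)" for s i
    by (auto intro!: sets_uss_noise_times)
  have E_sets: "E s \<in> sets ?M" for s unfolding E_def by measurable
  have U: "measure (uniform_measure lborel {0..<1::real}) UNIV = 1"
    using prob_space.prob_space[OF prob_space_unit_interval] by simp
  \<comment> \<open>As \<open>b\<close> is at least 1, a coin small enough for entry is too small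
    for any other position of the block; hence a good block determines its \<open>s\<close>.\<close>
  have "1 / (2 * real N) \<le> y" using b N by (simp add: y_def field_simps)
  hence disj: "?A s i \<inter> ?A t i = {}" if "i = s" "t \<noteq> s" for s t i
    using that by (auto simp: y_def)
  have "disjoint_family_on E {N..<2*N}"
    unfolding disjoint_family_on_def
  proof (intro ballI impI)
    fix s t assume st: "s \<in> {N..<2*N}" "t \<in> {N..<2*N}" "s \<noteq> t"
    hence "s \<in> ?I" using less_le_trans[OF _ LN, of s] by auto
    thus "E s \<inter> E t = {}" using disj[of s s t] st(3) unfolding E_def by blast
  qed
  have probE: "pmf P x / (2 * real N) * exp (- 2 * b * real L) \<le> S.prob (E s)" if s: "s \<in> {N..<2*N}" for s
  proof -
    have s': "s \<in> ?I" using s less_le_trans[OF _ LN, of s] by auto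
    have "prob ({x} \<times> UNIV \<times> {v. v < 1 / (2 * real N)}) = pmf P x / (2 * real N)"
      using uniform_measure_unit_interval(1)[of "1 / (2 * real N)"] N
      by (subst measure_uss_noise_times) (simp_all add: U measure_pmf_single del: measure_uniform_measure)
    moreover have "prob (UNIV \<times> UNIV \<times> {v. y \<le> v}) = 1 - y"
      using uniform_measure_unit_interval(2)[of y] y
      by (subst measure_uss_noise_times) (simp_all add: U del: measure_uniform_measure)
    ultimately have pr: "prob (?A s i) = (if i = s then pmf P x / (2 * real N) else 1 - y)" for i
      by (simp add: y_def)
    have "S.prob (E s) = (\<Prod>i\<in>?I. prob (?A s i))"
      unfolding E_def using s' by (intro prob_stream_space_cylinder A) blast+
    also have "\<dots> = pmf P x / (2 * real N) * (\<Prod>i\<in>?I - {s}. 1 - y)"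
      unfolding pr by (subst prod.remove[OF _ s']) (auto intro!: prod.cong)
    also have "(\<Prod>i\<in>?I - {s}. 1 - y) = (1 - y) ^ card (?I - {s})" by simp
    finally have eq: "S.prob (E s) = pmf P x / (2 * real N) * (1 - y) ^ card (?I - {s})" .
    \<comment> \<open>Since \<open>y * N = b\<close>, the exponent no longer contains
      \<open>N\<close>.\<close>
    have "exp (- 2 * b * real L) = exp (- 2 * y * real (L * N))"
      using N by (simp add: y_def)
    also have "\<dots> \<le> (1 - y) ^ (L * N)" using y by (rule exp_le_one_minus_power)
    also have "\<dots> \<le> (1 - y) ^ card (?I - {s})"
    proof (rule power_decreasing)
      have "card (?I - {s}) \<le> card ?I" by (intro card_mono) auto
      thus "card (?I - {s}) \<le> L * N" by simp
    qed (use y in auto)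
    finally show ?thesis unfolding eq by (intro mult_left_mono) auto
  qed
  have "pmf P x / 2 * exp (- 2 * b * real L) = (\<Sum>s\<in>{N..<2*N}. pmf P x / (2 * real N) * exp (- 2 * b * real L))"
    using N by simp
  also have "\<dots> \<le> (\<Sum>s\<in>{N..<2*N}. S.prob (E s))" by (intro sum_mono probE)
  also have "\<dots> = S.prob (\<Union>s\<in>{N..<2*N}. E s)"
    using E_sets \<open>disjoint_family_on E _\<close> by (intro S.finite_measure_finite_Union[symmetric]) auto
  also have "(\<Union>s\<in>{N..<2*N}. E s) = {\<omega>\<in>space ?M. \<exists>s\<in>{N..<2*N}. \<forall>i\<in>?I. \<omega> !! i \<in> ?A s i}"
    by (auto simp: E_def)
  finally show ?thesis .
qed

text \<open>The blocks from \<open>L^k\<close> to \<open>L^(k+1)\<close> are disjoint, so their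
  events are independent, and their probabilities are bounded below uniformly for large
  \<open>k\<close>.\<close>

lemma AE_good_blocks:
  fixes L :: nat and b :: real
  assumes b: "1 \<le> b" and L: "2 \<le> L" and x: "0 < pmf P x"
  shows "AE \<omega> in stream_space (uss_noise P). \<exists>\<^sub>\<infinity>k. \<exists>s\<in>{L^k..<2*L^k}.
    fst (\<omega> !! s) = x \<and> snd (snd (\<omega> !! s)) < 1 / (2 * real (L^k)) \<and>
    (\<forall>i\<in>{L^k..<L*L^k} - {s}. b / real (L^k) \<le> snd (snd (\<omega> !! i)))"
proof -
  interpret prob_space "uss_noise P" by (rule prob_space_uss_noise)
  interpret S: prob_space "stream_space (uss_noise P)" by (rule prob_space_stream_space)
  define A :: "nat \<Rightarrow> nat \<Rightarrow> nat \<Rightarrow> (nat \<times> real \<times> real) set" where "A = (\<lambda>N s i. if i = s then {x} \<times> UNIV \<times> {v. v < 1 / (2 * real N)}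
    else UNIV \<times> UNIV \<times> {v. b / real N \<le> v})"
  have A[measurable]: "A N s i \<in> sets (uss_noise P)" for N s i
    unfolding A_def by (auto intro!: sets_uss_noise_times)
  define K where "K = (\<lambda>k. {L^k..<L*L^k})"
  define Q where "Q = (\<lambda>k (f :: nat \<Rightarrow> nat \<times> real \<times> real). \<exists>s\<in>{L^k..<2*L^k}. \<forall>i\<in>K k. f i \<in> A (L^k) s i)"
  define E where "E = (\<lambda>k. {\<omega>\<in>space (stream_space (uss_noise P)). Q k (\<lambda>i. \<omega> !! i)})"
  have "K k \<inter> K l = {}" if "k < l" for k l
  proof -
    have "L ^ Suc k \<le> L ^ l" using that L by (intro power_increasing) auto
    thus ?thesis by (auto simp: K_def)
  qed
  hence "disjoint_family K"
    unfolding disjoint_family_on_def by (metis Int_commute linorder_neqE_nat)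
  moreover have "{f\<in>space (\<Pi>\<^sub>M i\<in>K k. uss_noise P). Q k f} \<in> sets (\<Pi>\<^sub>M i\<in>K k. uss_noise P)" for k
  proof -
    have fin: "finite (K k)" by (simp add: K_def)
    have [measurable]: "Measurable.pred (\<Pi>\<^sub>M i\<in>K k. uss_noise P) (\<lambda>f. f i \<in> A (L^k) s i)" if "i \<in> K k" for i s
      using measurable_component_singleton[OF that, of "\<lambda>_. uss_noise P"] by measurable
    have "Measurable.pred (\<Pi>\<^sub>M i\<in>K k. uss_noise P) (Q k)"
      unfolding Q_def using fin by (intro pred_intros_finite) auto
    thus ?thesis by measurable
  qed
  moreover have "Q k (restrict f (K k)) = Q k f" for k f by (simp add: Q_def)
  ultimately have "S.indep_events E UNIV"
    unfolding E_def by (rule indep_events_stream_space_blocks)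
  moreover have "pmf P x / 2 * exp (- 2 * b * real L) \<le> S.prob (E k)" if k: "k \<ge> nat \<lceil>2 * b\<rceil>" for k
  proof -
    have "k < L ^ k" using L by (intro power_gt_expt) auto
    hence "2 * b \<le> real (L ^ k)" using k by linarith
    from prob_good_block_ge[OF b this L, of P x] show ?thesis
      by (simp add: E_def Q_def K_def A_def)
  qed
  ultimately have "AE \<omega> in stream_space (uss_noise P). \<exists>\<^sub>\<infinity>k. \<omega> \<in> E k"
    using x by (intro S.borel_cantelli_indep_AE[where c = "pmf P x / 2 * exp (- 2 * b * real L)"
      and K = "nat \<lceil>2 * b\<rceil>"]) auto
  thus ?thesis
  proof eventually_elim
    case (elim \<omega>)
    thus ?case
    proof (rule INFM_mono)
      fix k assume "\<omega> \<in> E k"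
      then obtain s where s: "s \<in> {L^k..<2*L^k}" "\<forall>i\<in>K k. \<omega> !! i \<in> A (L^k) s i"
        by (auto simp: E_def Q_def)
      have LL: "2 * L^k \<le> L * L^k" using L by simp
      hence sK: "s \<in> K k" using s(1) less_le_trans[OF _ LL, of s] by (auto simp: K_def)
      have "fst (\<omega> !! s) = x" "snd (snd (\<omega> !! s)) < 1 / (2 * real (L^k))"
        using s(2)[rule_format, OF sK] by (simp_all add: A_def mem_Times_iff)
      moreover have "b / real (L^k) \<le> snd (snd (\<omega> !! i))" if "i \<in> {L^k..<L*L^k} - {s}" for i
        using s(2)[rule_format, of i] that by (simp add: A_def K_def mem_Times_iff)
      ultimately show "\<exists>s\<in>{L^k..<2*L^k}. fst (\<omega> !! s) = x \<and> snd (snd (\<omega> !! s)) < 1 / (2 * real (L^k)) \<and>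
          (\<forall>i\<in>{L^k..<L*L^k} - {s}. b / real (L^k) \<le> snd (snd (\<omega> !! i)))"
        using s(1) by blast
    qed
  qed
qed

section \<open>Combination of the deterministic criteria with the almost sure events\<close>

theorem theorem3:
  fixes P :: "nat pmf" and m :: nat
  assumes "m > 0"
    and "\<And>i j. i \<le> j \<Longrightarrow> pmf P j \<le> pmf P i"
    and "pmf P 0 > 1 / real m"
  shows "AE \<omega> in stream_space (uss_noise P). \<exists>T. \<forall>t\<ge>T. uss_Z 0 (uss_run m \<omega> t)"
proof -
  define p where "p = pmf P 0"
  have p: "1 / real m < p" "p \<le> 1" using assms(3) by (auto simp: p_def pmf_le_1)
  have "0 < 1 / real m" using assms(1) by simp
  hence p0: "0 < p" using p by linarith
  show ?thesis
  \<comment> \<open>As the probabilities decrease, item \<open>m\<close> decides: either only the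
    \<open>m\<close> items below it occur, or all \<open>m + 1\<close> items up to it have positive
    probability.\<close>
  proof (cases "pmf P m = 0")
    case True
    have items: "i < m" if "i \<in> set_pmf P" for i
    proof (rule ccontr)
      assume "\<not> i < m"
      hence "pmf P i \<le> 0" using assms(2)[of m i] True by simp
      thus False using that by (simp add: pmf_positive_iff[symmetric])
    qed
    have "AE \<omega> in stream_space (uss_noise P). \<exists>T. \<forall>n\<ge>T.
        \<bar>real (arrivals \<omega> n) - p * real n\<bar> \<le> p / 2 * real n"
      unfolding arrivals_def p_def using p0 by (intro AE_arrival_frequency) (simp add: p_def)
    thus ?thesis
      using AE_items_in_set_pmf[of P] AE_valid_noise[of P]
    proof eventually_elim
      case (elim \<omega>)
      \<comment> \<open>A deviation of at most half the expected number forces at least one arrival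
        of item 0.\<close>
      then obtain T where "\<bar>real (arrivals \<omega> (Suc T)) - p * real (Suc T)\<bar> \<le> p / 2 * real (Suc T)"
        by (meson le_SucI order_refl)
      moreover have "p * real (Suc T) > p / 2 * real (Suc T)"
        using p0 by (intro mult_strict_right_mono) auto
      ultimately have "arrivals \<omega> (Suc T) \<noteq> 0" by linarith
      hence "{i. i < Suc T \<and> fst (\<omega> !! i) = 0} \<noteq> {}" unfolding arrivals_def by (metis card.empty)
      then obtain s where "fst (\<omega> !! s) = 0" by blast
      thus ?case using elim assms(1) items
        by (intro eventually_tracked_if_few_items) auto
    qed
  next
    case False
    define \<epsilon> where "\<epsilon> = (p - 1 / real m) / 4"
    define q where "q = (\<Prod>i\<le>m. pmf P i)"
    \<comment> \<open>The second entry is the growth constant for window frequency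
      \<open>q / 2\<close>, half of the true one; the maximum with 1 serves the disjointness within
      a good block.\<close>
    define b where "b = max 1 (2 * real m * real (Suc m) / (q / 2))"
    define L where "L = max 2 (nat \<lceil>4 / \<epsilon>\<rceil>)"
    have "4 * \<epsilon> = p - 1 / real m" unfolding \<epsilon>_def by simp
    hence \<epsilon>: "0 < \<epsilon>" "1 / real m + 4 * \<epsilon> = p" using p by linarith+
    have "0 < pmf P m" using False by (simp add: pmf_pos)
    hence "0 < pmf P i" if "i \<le> m" for i using assms(2)[OF that] by linarith
    hence q: "0 < q" unfolding q_def by (intro prod_pos) auto
    have L: "2 \<le> L" "4 \<le> \<epsilon> * real L"
    proof -
      have "4 / \<epsilon> \<le> real L" unfolding L_def by linarith
      thus "4 \<le> \<epsilon> * real L" using \<epsilon>(1) by (simp add: field_simps)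
    qed (simp add: L_def)
    have "AE \<omega> in stream_space (uss_noise P). \<exists>T. \<forall>n\<ge>T. \<bar>real (arrivals \<omega> n) - p * real n\<bar> \<le> \<epsilon> * real n"
      unfolding arrivals_def p_def using \<epsilon>(1) by (rule AE_arrival_frequency)
    moreover have "AE \<omega> in stream_space (uss_noise P). \<exists>T. \<forall>n\<ge>T.
        \<bar>real (card {j. j < n \<and> (\<forall>i\<le>m. fst (\<omega> !! (j * Suc m + i)) = i)}) - q * real n\<bar> \<le> q / 2 * real n"
      unfolding q_def using q by (intro AE_window_frequency) (simp add: q_def)
    moreover have "AE \<omega> in stream_space (uss_noise P). \<exists>\<^sub>\<infinity>k. \<exists>s\<in>{L^k..<2*L^k}.
        fst (\<omega> !! s) = 0 \<and> snd (snd (\<omega> !! s)) < 1 / (2 * real (L^k)) \<and>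
        (\<forall>i\<in>{L^k..<L*L^k} - {s}. b / real (L^k) \<le> snd (snd (\<omega> !! i)))"
      using L p0 by (intro AE_good_blocks) (auto simp: b_def p_def)
    ultimately show ?thesis
      using AE_valid_noise[of P]
    proof eventually_elim
      case (elim \<omega>)
      then obtain T1 T2
        where T1: "\<And>n. n \<ge> T1 \<Longrightarrow> \<bar>real (arrivals \<omega> n) - p * real n\<bar> \<le> \<epsilon> * real n"
          and T2: "\<And>n. n \<ge> T2 \<Longrightarrow> \<bar>real (card {j. j < n \<and> (\<forall>i\<le>m. fst (\<omega> !! (j * Suc m + i)) = i)}) - q * real n\<bar>
            \<le> q / 2 * real n"
        by blast
      have growth: "real t \<le> b * (real (min_count (uss_run m \<omega> t)) + 1)" if "t \<ge> Suc T2 * Suc m" for t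
      proof -
        have "q / 2 * real n \<le> real (card {j. j < n \<and> (\<forall>i\<le>m. fst (\<omega> !! (j * Suc m + i)) = i)})"
          if "n \<ge> T2" for n
        proof -
          have "q * real n = q / 2 * real n + q / 2 * real n" by simp
          thus ?thesis using T2[OF that] by linarith
        qed
        hence "real t \<le> 2 * real m * real (Suc m) / (q / 2) * (real (min_count (uss_run m \<omega> t)) + 1)"
          using assms(1) elim(4) q that by (intro min_count_linear_growth) auto
        also have "\<dots> \<le> b * (real (min_count (uss_run m \<omega> t)) + 1)"
          by (intro mult_right_mono) (auto simp: b_def)
        finally show ?thesis .
      qed
      show ?case
        by (rule eventually_tracked_if_good_blocks[OF assms(1) elim(4) \<epsilon> p(2) L T1 growth elim(3)])
    qed
  qed
qed

end
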